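(* Let $(V,M)$ be a strongly regular multigraph with $n=|V|$ vertices, and let $a,b,c,d\in\mathbb{R}$ be such that $(M^2)_{ij}=aM_{ij}+b$ for all $i\neq j$, $(M^2)_{ii}=c$ for all $i$, and $MJ=dJ$, where $J$ is the all-ones matrix. Then the spectrum of $M$ has two possibilities. Either (1) it consists of exactly two values $\frac{-d}{n-1}<d$ with multiplicities $n-1$ and $1$ respectively; or (2) it consists of exactly three values $\eta_-<\eta_+<d$ with corresponding multiplicities $f_-,f_+,1$, given by $$\eta_{\mp}=\frac{a\mp\sqrt{a^2+4(c-b)}}{2},\qquad f_{\mp}=\pm\frac{d+(n-1)\eta_{\pm}}{\eta_+-\eta_-}.$$
   Context: A multigraph $(V,M)$ is a finite set $V$ together with a function $M:V\times V\to\mathbb{R}_{\ge0}$ that is symmetric and zero on the diagonal, regarded as a symmetric matrix. The multigraph is strongly regular if real numbers $a,b,c,d$ with the three properties listed in the claim exist.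
   Formalization: The multigraph is assumed connected with n ≥ 2; otherwise the claim fails: two disjoint edges (a=b=0, c=d=1) have spectrum {-1,1} with multiplicities 2,2, and for n=1 the value -d/(n-1) is undefined. *)

theory Defs
  imports "Jordan_Normal_Form.Spectral_Radius"
begin

definition multigraph :: "'v set \<Rightarrow> ('v \<Rightarrow> 'v \<Rightarrow> real) \<Rightarrow> bool" where
  "multigraph V M \<longleftrightarrow> finite V
     \<and> (\<forall>u\<in>V. \<forall>v\<in>V. M u v \<ge> 0)
     \<and> (\<forall>u\<in>V. \<forall>v\<in>V. M u v = M v u)
     \<and> (\<forall>v\<in>V. M v v = 0)"

definition connected_multigraph :: "'v set \<Rightarrow> ('v \<Rightarrow> 'v \<Rightarrow> real) \<Rightarrow> bool" where
  "connected_multigraph V M \<longleftrightarrow>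
     (\<forall>u\<in>V. \<forall>v\<in>V. (u, v) \<in> {(x, y). x \<in> V \<and> y \<in> V \<and> M x y > 0}\<^sup>*)"

text \<open>Matrices of the library are indexed by numbers, so the matrix of a multigraph is taken
  with respect to an enumeration \<open>vs\<close> of the vertex set, i.e. a distinct list with
  \<open>set vs = V\<close>.  Different enumerations give permutation-similar matrices.\<close>

definition adjacency_matrix :: "'v list \<Rightarrow> ('v \<Rightarrow> 'v \<Rightarrow> real) \<Rightarrow> real mat" where
  "adjacency_matrix vs M =
     mat (length vs) (length vs) (\<lambda>(i, j). M (vs ! i) (vs ! j))"

definition all_ones :: "nat \<Rightarrow> real mat" where
  "all_ones n = mat n n (\<lambda>_. 1)"

definition strongly_regular_with ::
    "nat \<Rightarrow> real mat \<Rightarrow> real \<Rightarrow> real \<Rightarrow> real \<Rightarrow> real \<Rightarrow> bool" where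
  "strongly_regular_with n A a b c d \<longleftrightarrow>
     (\<forall>i<n. \<forall>j<n. i \<noteq> j \<longrightarrow> (A * A) $$ (i, j) = a * A $$ (i, j) + b)
     \<and> (\<forall>i<n. (A * A) $$ (i, i) = c)
     \<and> A * all_ones n = d \<cdot>\<^sub>m all_ones n"

text \<open>Algebraic multiplicity; for the symmetric real matrices considered here it coincides
  with the dimension of the eigenspace.\<close>

definition multiplicity_of :: "real \<Rightarrow> real mat \<Rightarrow> nat" where
  "multiplicity_of x A = Polynomial.order x (char_poly A)"

end

theory Submission
  imports Defs
begin

text \<open>
  A real symmetric matrix \<open>A\<close> has a characteristic polynomial that splits over the reals, so its
  spectrum is a list of \<open>n\<close> real roots.  Strong regularity says \<open>A\<^sup>2 = aA + (c - b)I + bJ\<close>.  An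
  eigenvector for an eigenvalue other than \<open>d\<close> is orthogonal to the all-ones vector and is
  therefore killed by \<open>J\<close>, so that eigenvalue is a root of \<open>q(x) = x\<^sup>2 - ax - (c - b)\<close>, that is, \<open>\<eta>\<^sub>-\<close>
  or \<open>\<eta>\<^sub>+\<close>; on the all-ones vector the same identity gives \<open>q(d) = nb\<close>.

  The crux is that \<open>d\<close> is a simple root (\<open>degree_multiplicity_one\<close>).  The sum of \<open>q\<close> over all roots is
  the trace of \<open>q(A) = bJ\<close>, namely \<open>nb\<close>, and only the roots equal to \<open>d\<close> contribute, each with
  \<open>q(d) = nb\<close>.  This settles \<open>b \<noteq> 0\<close>.  If \<open>b = 0\<close>, then \<open>q(x) = (x - d)(x - (a - d))\<close>, so
  \<open>(A - dI)(A - (a - d)I) = 0\<close> and the columns of the second factor are eigenvectors for \<open>d\<close>.  By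
  connectedness they are constant, so \<open>A\<close> is a multiple of the adjacency matrix of the complete
  graph, and the trace determines the multiplicity.

  Both the constancy of such eigenvectors and the bound \<open>\<eta>\<^sub>+ \<le> d\<close> come from the Dirichlet form
  \<open>\<Sum> A\<^sub>i\<^sub>j (f\<^sub>i - f\<^sub>j)\<^sup>2 = 2 (d - e) \<Sum> f\<^sub>i\<^sup>2\<close> of an eigenvector \<open>f\<close> with eigenvalue \<open>e\<close>.
  If only one root differs from \<open>d\<close>, the zero trace forces it to be \<open>-d/(n-1)\<close>; if both \<open>\<eta>\<^sub>-\<close> and \<open>\<eta>\<^sub>+\<close>
  occur, their multiplicities solve the two linear equations given by the number of roots and
  by the trace.
\<close>

section \<open>Characteristic roots and traces\<close>

lemma index_mult_mat_sum:
  fixes A B :: "'a :: semiring_0 mat"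
  assumes "A \<in> carrier_mat n m" "B \<in> carrier_mat m k" "i < n" "j < k"
  shows "(A * B) $$ (i, j) = (\<Sum>l<m. A $$ (i, l) * B $$ (l, j))"
  using assms by (auto simp: scalar_prod_def atLeast0LessThan intro!: sum.cong)

lemma trace_mult_commute:
  fixes A B :: "'a :: comm_semiring_0 mat"
  assumes "A \<in> carrier_mat n n" "B \<in> carrier_mat n n"
  shows "(\<Sum>i<n. (A * B) $$ (i, i)) = (\<Sum>i<n. (B * A) $$ (i, i))"
proof -
  have "(\<Sum>i<n. (A * B) $$ (i, i)) = (\<Sum>i<n. \<Sum>l<n. A $$ (i, l) * B $$ (l, i))"
    using index_mult_mat_sum[OF assms] by simp
  also have "\<dots> = (\<Sum>l<n. \<Sum>i<n. B $$ (l, i) * A $$ (i, l))"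
    by (subst sum.swap) (simp add: mult.commute)
  also have "\<dots> = (\<Sum>i<n. (B * A) $$ (i, i))"
    using index_mult_mat_sum[OF assms(2,1)] by simp
  finally show ?thesis .
qed

lemma trace_similar:
  fixes A B :: "'a :: comm_ring_1 mat"
  assumes "similar_mat_wit A B P Q" "A \<in> carrier_mat n n"
  shows "(\<Sum>i<n. A $$ (i, i)) = (\<Sum>i<n. B $$ (i, i))"
proof -
  note w = similar_mat_witD2[OF assms(2,1)]
  have "(\<Sum>i<n. A $$ (i, i)) = (\<Sum>i<n. ((P * B) * Q) $$ (i, i))"
    using w(3) by simp
  also have "\<dots> = (\<Sum>i<n. (Q * (P * B)) $$ (i, i))"
    by (rule trace_mult_commute) (use w in auto)
  also have "Q * (P * B) = B"
    using w(2) assoc_mult_mat[OF w(7,6,5)] w(5) by simp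
  finally show ?thesis .
qed

lemma similar_mat_wit_square:
  assumes "similar_mat_wit A B P Q" "A \<in> carrier_mat n n"
  shows "similar_mat_wit (A * A) (B * B) P Q"
  using similar_mat_wit_pow[OF assms(1), of 2] similar_mat_witD2[OF assms(2,1)]
  by (simp add: numeral_2_eq_2)

text \<open>Schur's triangularisation puts the characteristic roots on the diagonal of a triangular matrix
  similar to \<open>A\<close>, and squaring a triangular matrix squares its diagonal.\<close>

lemma trace_eq_sum_char_roots:
  fixes A :: "'a :: conjugatable_ordered_field mat"
  assumes A: "A \<in> carrier_mat n n"
    and split: "char_poly A = (\<Prod>e\<leftarrow>es. [:- e, 1:])"
  shows "(\<Sum>i<n. A $$ (i, i)) = sum_list es"
    and "(\<Sum>i<n. (A * A) $$ (i, i)) = (\<Sum>e\<leftarrow>es. e\<^sup>2)"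
proof -
  obtain B P Q where dec: "schur_decomposition A es = (B, P, Q)"
    by (cases "schur_decomposition A es") auto
  from schur_decomposition[OF A split dec]
  have sim: "similar_mat_wit A B P Q" and ut: "upper_triangular B" and diag: "diag_mat B = es"
    by auto
  have B: "B \<in> carrier_mat n n" using similar_mat_witD2[OF A sim] by blast
  have es: "es = map (\<lambda>i. B $$ (i, i)) [0..<n]"
    using diag B by (simp add: diag_mat_def)
  show "(\<Sum>i<n. A $$ (i, i)) = sum_list es"
    unfolding trace_similar[OF sim A] es
    by (simp add: interv_sum_list_conv_sum_set_nat atLeast0LessThan)
  have "(B * B) $$ (i, i) = (B $$ (i, i))\<^sup>2" if i: "i < n" for i
  proof -
    have "(B * B) $$ (i, i) = (\<Sum>l<n. B $$ (i, l) * B $$ (l, i))"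
      by (rule index_mult_mat_sum[OF B B i i])
    also have "\<dots> = (\<Sum>l<n. if l = i then (B $$ (i, i))\<^sup>2 else 0)"
    proof (rule sum.cong[OF refl])
      fix l assume l: "l \<in> {..<n}"
      consider "l < i" | "l = i" | "i < l" by linarith
      then show "B $$ (i, l) * B $$ (l, i) = (if l = i then (B $$ (i, i))\<^sup>2 else 0)"
        using upper_triangularD[OF ut] B i l by cases (auto simp: power2_eq_square)
    qed
    finally show ?thesis using i by simp
  qed
  then show "(\<Sum>i<n. (A * A) $$ (i, i)) = (\<Sum>e\<leftarrow>es. e\<^sup>2)"
    unfolding trace_similar[OF similar_mat_wit_square[OF sim A] mult_carrier_mat[OF A A]] es
    by (simp add: interv_sum_list_conv_sum_set_nat atLeast0LessThan o_def)
qed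

lemma order_prod_linear_factors:
  fixes x :: "'a :: idom"
  shows "Polynomial.order x (\<Prod>e\<leftarrow>es. [:- e, 1:]) = count_list es x"
proof (induction es)
  case Nil
  then show ?case by (simp add: order_0I)
next
  case (Cons e es)
  have nz: "(\<Prod>e\<leftarrow>e # es. [:- e, 1:]) \<noteq> 0"
    using prod_list_zero_iff[of "map (\<lambda>e. [:- e, 1:]) (e # es)"] by auto
  have "Polynomial.order x [:- e, 1:] = (if e = x then 1 else 0)"
  proof (cases "e = x")
    case True
    then show ?thesis using order_power_n_n[of x 1] by simp
  qed (simp add: order_0I)
  moreover have "Polynomial.order x (\<Prod>e\<leftarrow>e # es. [:- e, 1:])
      = Polynomial.order x [:- e, 1:] + Polynomial.order x (\<Prod>e\<leftarrow>es. [:- e, 1:])"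
    using order_mult[of "[:- e, 1:]" "\<Prod>e\<leftarrow>es. [:- e, 1:]" x] nz
    unfolding list.map prod_list.Cons by blast
  ultimately show ?case using Cons.IH by simp
qed

lemma sum_list_eq_sum_count:
  fixes f :: "'a \<Rightarrow> 'b :: semiring_1"
  assumes "finite X" "set es \<subseteq> X"
  shows "(\<Sum>e\<leftarrow>es. f e) = (\<Sum>x\<in>X. of_nat (count_list es x) * f x)"
  using assms(2)
proof (induction es)
  case (Cons e es)
  have "(\<Sum>x\<in>X. of_nat (count_list (e # es) x) * f x)
      = (\<Sum>x\<in>X. (if x = e then f e else 0) + of_nat (count_list es x) * f x)"
    by (intro sum.cong refl) (simp add: distrib_right)
  then show ?case using Cons assms(1) by (simp add: sum.distrib)
qed simp

lemma sum_list_eq_count_if_zero_else: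
  fixes f :: "'a \<Rightarrow> 'b :: semiring_1"
  assumes "\<And>e. e \<in> set es \<Longrightarrow> e \<noteq> x \<Longrightarrow> f e = 0"
  shows "(\<Sum>e\<leftarrow>es. f e) = of_nat (count_list es x) * f x"
  using assms by (induction es) (auto simp: algebra_simps)

lemma spectrum_eq_char_roots:
  fixes A :: "'a :: field mat"
  assumes "A \<in> carrier_mat n n" "char_poly A = (\<Prod>e\<leftarrow>es. [:- e, 1:])"
  shows "spectrum A = set es"
  unfolding spectrum_def
  using eigenvalue_root_char_poly[OF assms(1)] assms(2)
  by (auto simp: poly_prod_list prod_list_zero_iff)

lemma eigenvector_index_sum:
  fixes A :: "'a :: comm_ring_1 mat"
  assumes "A \<in> carrier_mat n n" "eigenvector A v e" "i < n"
  shows "(\<Sum>j<n. A $$ (i, j) * v $ j) = e * v $ i"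
proof -
  have "(A *\<^sub>v v) $ i = (e \<cdot>\<^sub>v v) $ i" and v: "v \<in> carrier_vec n"
    using assms unfolding eigenvector_def by auto
  then show ?thesis
    using assms by (auto simp: scalar_prod_def atLeast0LessThan)
qed

lemma eigenvector_nonzero_index:
  assumes "A \<in> carrier_mat n n" "eigenvector A v e"
  obtains i where "i < n" "v $ i \<noteq> 0"
  using assms unfolding eigenvector_def
  by (metis carrier_matD(1) carrier_vecD eq_vecI index_zero_vec)

text \<open>The Hermitian form of a real symmetric matrix is real-valued; at an eigenvector it is the
  eigenvalue times a positive number.\<close>

lemma symmetric_complex_eigenvalue_real:
  fixes A :: "real mat"
  assumes A: "A \<in> carrier_mat n n"
    and sym: "\<And>i j. i < n \<Longrightarrow> j < n \<Longrightarrow> A $$ (i, j) = A $$ (j, i)"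
    and ev: "eigenvalue (map_mat complex_of_real A) z"
  shows "z \<in> \<real>"
proof -
  let ?A = "map_mat complex_of_real A"
  obtain v where v: "eigenvector ?A v z" using ev unfolding eigenvalue_def by blast
  have cA: "?A \<in> carrier_mat n n" using A by simp
  define q where "q = (\<Sum>i<n. \<Sum>j<n. cnj (v $ i) * complex_of_real (A $$ (i, j)) * v $ j)"
  define s where "s = (\<Sum>i<n. (cmod (v $ i))\<^sup>2)"
  have "q = (\<Sum>i<n. cnj (v $ i) * (\<Sum>j<n. ?A $$ (i, j) * v $ j))"
    unfolding q_def using A by (auto simp: sum_distrib_left mult.assoc intro!: sum.cong)
  also have "\<dots> = (\<Sum>i<n. cnj (v $ i) * (z * v $ i))"
    using eigenvector_index_sum[OF cA v] by simp
  also have "\<dots> = z * complex_of_real s"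
    unfolding s_def of_real_sum sum_distrib_left
    by (rule sum.cong) (simp_all only: complex_norm_square mult_ac)
  finally have q: "q = z * complex_of_real s" .
  have "cnj q = (\<Sum>j<n. \<Sum>i<n. v $ i * complex_of_real (A $$ (i, j)) * cnj (v $ j))"
    unfolding q_def by (subst sum.swap) simp
  also have "\<dots> = q"
    unfolding q_def by (intro sum.cong refl) (simp add: sym mult_ac)
  finally have "cnj z * complex_of_real s = z * complex_of_real s"
    using q by simp
  moreover have "s > 0"
  proof -
    obtain i where "i < n" "v $ i \<noteq> 0" using eigenvector_nonzero_index[OF cA v] .
    then show ?thesis unfolding s_def by (intro sum_pos2[of _ i]) auto
  qed
  ultimately show ?thesis by (simp add: Reals_cnj_iff)
qed

lemma inj_map_poly_of_real: "inj (map_poly complex_of_real)"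
proof -
  interpret map_poly_inj_comm_ring_hom complex_of_real ..
  show ?thesis by (rule inj_f)
qed

text \<open>Over the complex numbers the characteristic polynomial splits; its roots are eigenvalues, hence
  real, and a real polynomial is determined by its complex image.\<close>

lemma symmetric_char_poly_splits:
  fixes A :: "real mat"
  assumes A: "A \<in> carrier_mat n n"
    and sym: "\<And>i j. i < n \<Longrightarrow> j < n \<Longrightarrow> A $$ (i, j) = A $$ (j, i)"
  obtains es where "char_poly A = (\<Prod>e\<leftarrow>es. [:- e, 1:])" "length es = n"
proof -
  let ?A = "map_mat complex_of_real A"
  have cA: "?A \<in> carrier_mat n n" using A by simp
  obtain zs where zs: "char_poly ?A = (\<Prod>z\<leftarrow>zs. [:- z, 1:])" "length zs = n"
    using char_poly_factorized[OF cA] by blast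
  have real: "z \<in> \<real>" if "z \<in> set zs" for z
    using symmetric_complex_eigenvalue_real[OF A sym] spectrum_eq_char_roots[OF cA zs(1)] that
    unfolding spectrum_def by auto
  have "map_poly complex_of_real (\<Prod>e\<leftarrow>map Re zs. [:- e, 1:]) = (\<Prod>z\<leftarrow>zs. [:- z, 1:])"
    using real
  proof (induction zs)
    case (Cons z zs)
    interpret map_poly_comm_ring_hom complex_of_real ..
    have "map_poly complex_of_real [:- Re z, 1:] = [:- z, 1:]"
      using Cons.prems by simp
    moreover have "map_poly complex_of_real (\<Prod>e\<leftarrow>map Re zs. [:- e, 1:]) = (\<Prod>z\<leftarrow>zs. [:- z, 1:])"
      using Cons by simp
    ultimately show ?case
      unfolding list.map prod_list.Cons hom_mult by (rule arg_cong2)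
  qed simp
  also have "\<dots> = map_poly complex_of_real (char_poly A)"
    unfolding zs(1)[symmetric] by (rule of_real_hom.char_poly_hom[OF A])
  finally have "char_poly A = (\<Prod>e\<leftarrow>map Re zs. [:- e, 1:])"
    by (rule injD[OF inj_map_poly_of_real, symmetric])
  with zs(2) show thesis using that[of "map Re zs"] by simp
qed

section \<open>Regular connected weighted graphs\<close>

text \<open>Vertices are identified with their positions in an enumeration, so the combinatorial notions
  are those of the index set.\<close>

locale connected_regular_matrix =
  fixes n :: nat and A :: "real mat" and d :: real
  assumes carrier: "A \<in> carrier_mat n n"
    and multigraph: "multigraph {..<n} (\<lambda>i j. A $$ (i, j))"
    and connected: "connected_multigraph {..<n} (\<lambda>i j. A $$ (i, j))"
    and row_sum: "\<And>i. i < n \<Longrightarrow> (\<Sum>j<n. A $$ (i, j)) = d"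
    and two_le: "n \<ge> 2"
begin

lemma nonneg: "i < n \<Longrightarrow> j < n \<Longrightarrow> A $$ (i, j) \<ge> 0"
  and sym: "i < n \<Longrightarrow> j < n \<Longrightarrow> A $$ (i, j) = A $$ (j, i)"
  and diag: "i < n \<Longrightarrow> A $$ (i, i) = 0"
  using multigraph unfolding multigraph_def by auto

text \<open>Zero is included, so that constant functions and columns of matrices qualify without a check
  that they are nonzero.\<close>

definition eigenfunction :: "(nat \<Rightarrow> real) \<Rightarrow> real \<Rightarrow> bool" where
  "eigenfunction f e \<longleftrightarrow> (\<forall>i<n. (\<Sum>j<n. A $$ (i, j) * f j) = e * f i)"

lemma constant_if_constant_on_edges:
  assumes edge: "\<And>i j. i < n \<Longrightarrow> j < n \<Longrightarrow> A $$ (i, j) > 0 \<Longrightarrow> f i = f j"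
    and "i < n" "j < n"
  shows "f i = f j"
proof -
  have "(i, j) \<in> {(x, y). x \<in> {..<n} \<and> y \<in> {..<n} \<and> A $$ (x, y) > 0}\<^sup>*"
    using connected assms(2,3) unfolding connected_multigraph_def by blast
  then show ?thesis
    by (induction rule: rtrancl_induct) (auto dest: edge)
qed

lemma degree_pos: "d > 0"
proof (rule ccontr)
  assume "\<not> d > 0"
  then have "\<not> A $$ (i, j) > 0" if "i < n" "j < n" for i j
    using sum_pos2[of "{..<n}" j "\<lambda>j. A $$ (i, j)"] row_sum[of i] nonneg that by auto
  \<comment> \<open>Without edges every function is constant, even the identity.\<close>
  then have "(0 :: nat) = 1"
    using constant_if_constant_on_edges[of "\<lambda>i. i" 0 1] two_le by simp
  then show False by simp
qed

text \<open>Expanding the square gives two diagonal terms, each \<open>d\<close> times the squared norm by the row and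
  column sums, and a mixed term that the eigenvalue equation evaluates.\<close>

lemma dirichlet_form_eigenfunction:
  assumes "eigenfunction f e"
  shows "(\<Sum>i<n. \<Sum>j<n. A $$ (i, j) * (f i - f j)\<^sup>2) = 2 * (d - e) * (\<Sum>i<n. (f i)\<^sup>2)"
proof -
  let ?S = "\<Sum>i<n. (f i)\<^sup>2"
  have rows: "(\<Sum>i<n. \<Sum>j<n. A $$ (i, j) * (f i)\<^sup>2) = d * ?S"
    by (simp add: sum_distrib_left sum_distrib_right[symmetric] row_sum)
  then have cols: "(\<Sum>i<n. \<Sum>j<n. A $$ (i, j) * (f j)\<^sup>2) = d * ?S"
    by (subst sum.swap) (simp add: sym cong: sum.cong_simp)
  have "(\<Sum>i<n. \<Sum>j<n. f i * (A $$ (i, j) * f j)) = (\<Sum>i<n. f i * (e * f i))"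
    using assms by (simp add: eigenfunction_def sum_distrib_left[symmetric])
  also have "\<dots> = e * ?S"
    by (simp add: sum_distrib_left power2_eq_square mult_ac)
  finally have mixed: "(\<Sum>i<n. \<Sum>j<n. f i * (A $$ (i, j) * f j)) = e * ?S" .
  have "(\<Sum>i<n. \<Sum>j<n. A $$ (i, j) * (f i - f j)\<^sup>2)
    = (\<Sum>i<n. \<Sum>j<n. A $$ (i, j) * (f i)\<^sup>2 + A $$ (i, j) * (f j)\<^sup>2 - 2 * (f i * (A $$ (i, j) * f j)))"
    by (intro sum.cong refl) (simp add: power2_eq_square algebra_simps)
  also have "\<dots> = d * ?S + d * ?S - 2 * (e * ?S)"
    unfolding sum_subtractf sum.distrib rows cols
    unfolding mixed[symmetric] by (simp add: sum_distrib_left)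
  finally show ?thesis by (simp add: algebra_simps)
qed

lemma eigenvalue_le_degree:
  assumes "eigenfunction f e" "i < n" "f i \<noteq> 0"
  shows "e \<le> d"
proof -
  have "0 \<le> 2 * (d - e) * (\<Sum>i<n. (f i)\<^sup>2)"
    unfolding dirichlet_form_eigenfunction[OF assms(1), symmetric]
    by (intro sum_nonneg mult_nonneg_nonneg) (auto simp: nonneg)
  moreover have "(\<Sum>i<n. (f i)\<^sup>2) > 0"
    using assms by (intro sum_pos2[of _ i]) auto
  ultimately show ?thesis by (simp add: zero_le_mult_iff)
qed

text \<open>For the eigenvalue \<open>d\<close> the Dirichlet form vanishes, hence so does the difference of the values along every edge.\<close>

lemma degree_eigenfunction_constant:
  assumes "eigenfunction f d" "i < n" "j < n"
  shows "f i = f j"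
proof (rule constant_if_constant_on_edges[OF _ assms(2,3)])
  fix i j assume ij: "i < n" "j < n" "A $$ (i, j) > 0"
  have nn: "0 \<le> A $$ (k, l) * (f k - f l)\<^sup>2" if "k < n" "l < n" for k l
    using nonneg that by simp
  have "(\<Sum>i<n. \<Sum>j<n. A $$ (i, j) * (f i - f j)\<^sup>2) = 0"
    using dirichlet_form_eigenfunction[OF assms(1)] by simp
  then have "(\<Sum>j<n. A $$ (i, j) * (f i - f j)\<^sup>2) = 0"
    using ij(1) nn by (subst (asm) sum_nonneg_eq_0_iff) (auto intro!: sum_nonneg)
  then have "\<forall>j\<in>{..<n}. A $$ (i, j) * (f i - f j)\<^sup>2 = 0"
    using sum_nonneg_eq_0_iff[of "{..<n}" "\<lambda>j. A $$ (i, j) * (f i - f j)\<^sup>2"] nn[OF ij(1)]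
    by auto
  then have "A $$ (i, j) * (f i - f j)\<^sup>2 = 0"
    using ij(2) by blast
  with ij(3) show "f i = f j" by simp
qed

text \<open>The column sums of \<open>A\<close> are also \<open>d\<close>, so summing the eigenvalue equation over all rows multiplies
  the sum of \<open>f\<close> by \<open>d\<close> on one side and by \<open>e\<close> on the other.\<close>

lemma eigenfunction_sum_zero:
  assumes "eigenfunction f e" "e \<noteq> d"
  shows "(\<Sum>i<n. f i) = 0"
proof -
  have "e * (\<Sum>i<n. f i) = (\<Sum>i<n. \<Sum>j<n. A $$ (i, j) * f j)"
    using assms(1) by (simp add: eigenfunction_def sum_distrib_left)
  also have "\<dots> = (\<Sum>j<n. \<Sum>i<n. A $$ (j, i) * f j)"
    by (subst sum.swap) (simp add: sym cong: sum.cong_simp)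
  also have "\<dots> = d * (\<Sum>i<n. f i)"
    by (simp add: sum_distrib_left sum_distrib_right[symmetric] row_sum)
  finally show ?thesis using assms(2) by simp
qed

lemma eigenfunction_of_char_root:
  assumes "char_poly A = (\<Prod>e\<leftarrow>es. [:- e, 1:])" "e \<in> set es"
  obtains f i where "eigenfunction f e" "i < n" "f i \<noteq> 0"
proof -
  obtain v where v: "eigenvector A v e"
    using spectrum_eq_char_roots[OF carrier assms(1)] assms(2)
    unfolding spectrum_def eigenvalue_def by auto
  obtain i where "i < n" "v $ i \<noteq> 0" using eigenvector_nonzero_index[OF carrier v] .
  moreover have "eigenfunction (\<lambda>i. v $ i) e"
    using eigenvector_index_sum[OF carrier v] by (simp add: eigenfunction_def)
  ultimately show thesis using that by blast
qed

end

section \<open>Strongly regular multigraphs\<close>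

text \<open>The zero diagonal of \<open>A\<close> merges the two entrywise conditions into
  \<open>A\<^sup>2 = aA + bJ + (c - b)I\<close>.\<close>

locale strongly_regular_matrix = connected_regular_matrix +
  fixes a b c :: real
  assumes square: "\<And>i j. i < n \<Longrightarrow> j < n \<Longrightarrow>
    (\<Sum>l<n. A $$ (i, l) * A $$ (l, j)) = a * A $$ (i, j) + b + (if i = j then c - b else 0)"
begin

lemma eigenfunction_square:
  assumes "eigenfunction f e" "i < n"
  shows "(e\<^sup>2 - a * e - (c - b)) * f i = b * (\<Sum>j<n. f j)"
proof -
  have "e\<^sup>2 * f i = (\<Sum>l<n. A $$ (i, l) * (e * f l))"
    using assms by (simp add: eigenfunction_def power2_eq_square mult.left_commute
        sum_distrib_left[symmetric])
  also have "\<dots> = (\<Sum>l<n. \<Sum>j<n. A $$ (i, l) * A $$ (l, j) * f j)"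
    using assms(1) by (intro sum.cong refl)
      (simp add: eigenfunction_def sum_distrib_left[symmetric] mult.assoc)
  also have "\<dots> = (\<Sum>j<n. (\<Sum>l<n. A $$ (i, l) * A $$ (l, j)) * f j)"
    by (subst sum.swap) (simp add: sum_distrib_right)
  also have "\<dots> = (\<Sum>j<n. a * (A $$ (i, j) * f j) + b * f j + (if i = j then (c - b) * f j else 0))"
    by (intro sum.cong refl) (auto simp: square assms(2) distrib_right mult.assoc)
  also have "\<dots> = a * (e * f i) + b * (\<Sum>j<n. f j) + (c - b) * f i"
    using assms by (simp add: sum.distrib sum_distrib_left[symmetric] eigenfunction_def)
  finally show ?thesis by (simp add: algebra_simps)
qed

lemma degree_quadratic: "d\<^sup>2 - a * d - (c - b) = real n * b"
proof -
  have "eigenfunction (\<lambda>_. 1) d" by (simp add: eigenfunction_def row_sum)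
  from eigenfunction_square[OF this, of 0] show ?thesis using two_le by simp
qed

lemma char_root_quadratic:
  assumes "char_poly A = (\<Prod>e\<leftarrow>es. [:- e, 1:])" "e \<in> set es" "e \<noteq> d"
  shows "e\<^sup>2 - a * e - (c - b) = 0"
proof -
  obtain f i where f: "eigenfunction f e" "i < n" "f i \<noteq> 0"
    using eigenfunction_of_char_root[OF assms(1,2)] .
  then show ?thesis
    using eigenfunction_square[OF f(1,2)] eigenfunction_sum_zero[OF f(1) assms(3)] by simp
qed

lemma char_roots_sum:
  assumes "char_poly A = (\<Prod>e\<leftarrow>es. [:- e, 1:])"
  shows "sum_list es = 0" and "(\<Sum>e\<leftarrow>es. e\<^sup>2) = real n * c"
proof -
  show "sum_list es = 0"
    using trace_eq_sum_char_roots(1)[OF carrier assms] by (simp add: diag)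
  have "(A * A) $$ (i, i) = c" if "i < n" for i
    using index_mult_mat_sum[OF carrier carrier that that] square[OF that that] that
    by (simp add: diag)
  then show "(\<Sum>e\<leftarrow>es. e\<^sup>2) = real n * c"
    using trace_eq_sum_char_roots(2)[OF carrier assms] by simp
qed

text \<open>For \<open>b = 0\<close> the columns of \<open>A - (a - d)I\<close> are eigenvectors for \<open>d\<close>, hence constant.  Comparing an
  off-diagonal entry with the diagonal entry \<open>-(a - d)\<close> of the same column shows that all
  off-diagonal entries of \<open>A\<close> agree.\<close>

lemma complete_if_offset_zero:
  assumes "b = 0" "i < n" "j < n" "i \<noteq> j"
  shows "A $$ (i, j) = d - a"
proof -
  \<comment> \<open>\<open>d\<close> and \<open>a - d\<close> are the two roots of \<open>x\<^sup>2 - ax - c\<close>.\<close>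
  have c: "d * (a - d) = - c"
    using degree_quadratic assms(1) by (simp add: power2_eq_square algebra_simps)
  define f where "f = (\<lambda>k. A $$ (k, j) - (if k = j then a - d else 0))"
  have "eigenfunction f d"
    unfolding eigenfunction_def
  proof (intro allI impI)
    fix k assume k: "k < n"
    have "(\<Sum>l<n. A $$ (k, l) * f l)
      = (\<Sum>l<n. A $$ (k, l) * A $$ (l, j) - (if l = j then A $$ (k, j) * (a - d) else 0))"
      unfolding f_def by (intro sum.cong refl) (auto simp: algebra_simps)
    also have "\<dots> = d * f k"
      using square[OF k assms(3)] assms(1,3) c unfolding f_def
      by (auto simp: sum_subtractf algebra_simps)
    finally show "(\<Sum>l<n. A $$ (k, l) * f l) = d * f k" .
  qed
  from degree_eigenfunction_constant[OF this assms(2,3)] assms(3,4)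
  show ?thesis by (simp add: f_def diag)
qed

text \<open>Both cases sum over all characteristic roots a function that vanishes at every root other than
  \<open>d\<close>: for \<open>b \<noteq> 0\<close> the quadratic itself, whose value \<open>nb\<close> at \<open>d\<close> is also its total; for \<open>b = 0\<close>, when
  the quadratic vanishes at \<open>d\<close> too, its linear factor with the other root.\<close>

lemma degree_multiplicity_one:
  assumes cp: "char_poly A = (\<Prod>e\<leftarrow>es. [:- e, 1:])" and len: "length es = n"
  shows "count_list es d = 1"
proof (cases "b = 0")
  case False
  let ?q = "\<lambda>x. x\<^sup>2 - a * x - (c - b)"
  have "(\<Sum>e\<leftarrow>es. ?q e) = (\<Sum>e\<leftarrow>es. e\<^sup>2) - a * sum_list es - real n * (c - b)"
    
    unfolding sum_list_subtractf sum_list_const_mult sum_list_triv len by (simp add: algebra_simps)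
  then have "(\<Sum>e\<leftarrow>es. ?q e) = real n * b"
    using char_roots_sum[OF cp] len by (simp add: algebra_simps)
  moreover have "(\<Sum>e\<leftarrow>es. ?q e) = real (count_list es d) * ?q d"
    using sum_list_eq_count_if_zero_else[of es d ?q] char_root_quadratic[OF cp] by blast
  ultimately show ?thesis
    using degree_quadratic False two_le by simp
next
  case True
  let ?h = "a - d"
  \<comment> \<open>The first row of the weighted complete graph ties the other root to the degree.\<close>
  have "d = (\<Sum>j<n. A $$ (0, j))" using row_sum two_le by simp
  also have "\<dots> = (\<Sum>j<n. - ?h + (if j = 0 then ?h else 0))"
    using complete_if_offset_zero[OF True, of 0] two_le by (intro sum.cong refl) (auto simp: diag)
  also have "\<dots> = ?h - real n * ?h"
    unfolding sum.distrib using two_le by (simp add: algebra_simps)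
  finally have d: "d - ?h = - real n * ?h" by simp
  have "e = ?h" if "e \<in> set es" "e \<noteq> d" for e
  proof -
    have "(e - d) * (e - ?h) = 0"
      using char_root_quadratic[OF cp that] degree_quadratic True
      by (simp add: power2_eq_square algebra_simps)
    with that show ?thesis by simp
  qed
  then have "(\<Sum>e\<leftarrow>es. e - ?h) = real (count_list es d) * (d - ?h)"
    using sum_list_eq_count_if_zero_else[of es d "\<lambda>e. e - ?h"] by auto
  moreover have "(\<Sum>e\<leftarrow>es. e - ?h) = - real n * ?h"
    unfolding sum_list_subtractf sum_list_triv len
    using char_roots_sum(1)[OF cp] by (simp add: algebra_simps)
  moreover have "d - ?h \<noteq> 0" using d degree_pos two_le by auto
  ultimately show ?thesis using d by simp
qed

lemma spectrum_dichotomy: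
  fixes \<eta>m \<eta>p :: real
  defines "\<eta>m \<equiv> (a - sqrt (a\<^sup>2 + 4 * (c - b))) / 2"
    and "\<eta>p \<equiv> (a + sqrt (a\<^sup>2 + 4 * (c - b))) / 2"
  shows "(- d / (real n - 1) < d
       \<and> spectrum A = {- d / (real n - 1), d}
       \<and> multiplicity_of (- d / (real n - 1)) A = n - 1
       \<and> multiplicity_of d A = 1)
     \<or> (\<eta>m < \<eta>p \<and> \<eta>p < d
       \<and> spectrum A = {\<eta>m, \<eta>p, d}
       \<and> real (multiplicity_of \<eta>m A) = (d + (real n - 1) * \<eta>p) / (\<eta>p - \<eta>m)
       \<and> real (multiplicity_of \<eta>p A) = - ((d + (real n - 1) * \<eta>m) / (\<eta>p - \<eta>m))
       \<and> multiplicity_of d A = 1)"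
proof -
  obtain es where cp: "char_poly A = (\<Prod>e\<leftarrow>es. [:- e, 1:])" and len: "length es = n"
    using symmetric_char_poly_splits[OF carrier sym] .
  have mult: "multiplicity_of x A = count_list es x" for x
    unfolding multiplicity_of_def cp by (rule order_prod_linear_factors)
  have spec: "spectrum A = set es" by (rule spectrum_eq_char_roots[OF carrier cp])
  have d1: "count_list es d = 1" by (rule degree_multiplicity_one[OF cp len])
  have "d \<in> set es" using d1 count_notin[of d es] by fastforce
  define S where "S = set es - {d}"
  have es: "set es = insert d S" "d \<notin> S" "finite S" using \<open>d \<in> set es\<close> S_def by auto
  have "(\<Sum>x\<in>set es. count_list es x) = n" using sum_count_set[of es "set es"] len by simp
  then have "1 + (\<Sum>x\<in>S. count_list es x) = n"
    using es d1 by simp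
  then have total: "real (\<Sum>x\<in>S. count_list es x) = real n - 1"
    by (metis add_diff_cancel_left' of_nat_1 of_nat_add)
  have "(\<Sum>x\<in>set es. real (count_list es x) * x) = 0"
    using char_roots_sum(1)[OF cp] sum_list_eq_sum_count[of "set es" es "\<lambda>x. x"] by simp
  then have trace: "d + (\<Sum>x\<in>S. real (count_list es x) * x) = 0"
    using es d1 by simp
  \<comment> \<open>Completing the square in the quadratic satisfied by the roots other than \<open>d\<close>.\<close>
  have root: "(2 * x - a)\<^sup>2 = a\<^sup>2 + 4 * (c - b)" if "x \<in> S" for x
    using char_root_quadratic[OF cp, of x] that S_def
    by (simp add: power2_eq_square algebra_simps)
  have "S \<subseteq> {\<eta>m, \<eta>p}"
  proof
    fix x assume "x \<in> S"
    then have "sqrt (a\<^sup>2 + 4 * (c - b)) = \<bar>2 * x - a\<bar>" using root by (metis real_sqrt_abs)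
    then show "x \<in> {\<eta>m, \<eta>p}" unfolding \<eta>m_def \<eta>p_def by (auto simp: abs_if split: if_splits)
  qed
  moreover have "S \<noteq> {}" using total two_le by auto
  ultimately consider x where "S = {x}" | "S = {\<eta>m, \<eta>p}" "\<eta>m \<noteq> \<eta>p" by blast
  \<comment> \<open>The first case covers \<open>\<eta>m = \<eta>p\<close> as well as one of two distinct values not occurring.\<close>
  then show ?thesis
  proof cases
    case 1
    have cnt: "real (count_list es x) = real n - 1" using total 1 by simp
    then have "d + (real n - 1) * x = 0" using trace 1 by simp
    then have x: "x = - d / (real n - 1)" using two_le by (simp add: field_simps)
    have "- d / (real n - 1) < 0" using degree_pos two_le by simp
    then have "x < d" using degree_pos x by linarith
    moreover have "set es = {x, d}" using es 1 by blast
    moreover have "count_list es x = n - 1" using cnt two_le by linarith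
    ultimately show ?thesis using d1 unfolding mult spec x[symmetric] by blast
  next
    case 2
    have cnt: "real (count_list es \<eta>m) + real (count_list es \<eta>p) = real n - 1"
      using total 2 by simp
    have tr: "d + real (count_list es \<eta>m) * \<eta>m + real (count_list es \<eta>p) * \<eta>p = 0"
      using trace 2 by simp
    obtain x where "x \<in> S" using 2 by blast
    \<comment> \<open>The discriminant is the square of a real number because its quadratic has a real root.\<close>
    have "0 \<le> a\<^sup>2 + 4 * (c - b)" unfolding root[OF \<open>x \<in> S\<close>, symmetric] by simp
    then have lt: "\<eta>m < \<eta>p" using 2(2) unfolding \<eta>m_def \<eta>p_def by auto
    obtain f i where "eigenfunction f \<eta>p" "i < n" "f i \<noteq> 0"
      using eigenfunction_of_char_root[OF cp, of \<eta>p] es 2 by blast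
    then have "\<eta>p \<le> d" by (rule eigenvalue_le_degree)
    then have "\<eta>p < d" using es(2) 2 by (auto simp: less_le)
    moreover have "real (count_list es \<eta>m) * (\<eta>p - \<eta>m) = d + (real n - 1) * \<eta>p"
      unfolding cnt[symmetric] using tr by (simp add: algebra_simps)
    then have "real (count_list es \<eta>m) = (d + (real n - 1) * \<eta>p) / (\<eta>p - \<eta>m)"
      using lt by (simp add: eq_divide_eq)
    moreover have "real (count_list es \<eta>p) * (\<eta>p - \<eta>m) = - (d + (real n - 1) * \<eta>m)"
      unfolding cnt[symmetric] using tr by (simp add: algebra_simps)
    then have "real (count_list es \<eta>p) = - ((d + (real n - 1) * \<eta>m) / (\<eta>p - \<eta>m))"
      unfolding minus_divide_left using lt by (simp add: eq_divide_eq)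
    moreover have "set es = {\<eta>m, \<eta>p, d}" using es 2 by blast
    ultimately show ?thesis using lt d1 unfolding mult spec by blast
  qed
qed

end

lemma connected_multigraph_enumeration:
  assumes "connected_multigraph V M" "distinct vs" "set vs = V"
  shows "connected_multigraph {..<length vs} (\<lambda>i j. M (vs ! i) (vs ! j))"
  unfolding connected_multigraph_def
proof (intro ballI)
  fix i j assume ij: "i \<in> {..<length vs}" "j \<in> {..<length vs}"
  define g where "g = inv_into {..<length vs} ((!) vs)"
  have bij: "bij_betw ((!) vs) {..<length vs} V"
    using assms(2,3) by (auto intro: bij_betw_nth)
  have gi: "g (vs ! k) = k" if "k < length vs" for k
    unfolding g_def using bij_betw_inv_into_left[OF bij] that by simp
  have gv: "g u < length vs" "vs ! g u = u" if "u \<in> V" for u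
    using bij_betw_inv_into_right[OF bij that] bij_betwE[OF bij_betw_inv_into[OF bij]] that
    unfolding g_def by auto
  have "(vs ! i, vs ! j) \<in> {(x, y). x \<in> V \<and> y \<in> V \<and> M x y > 0}\<^sup>*"
    using assms ij unfolding connected_multigraph_def by auto
  then have "(g (vs ! i), g (vs ! j)) \<in> {(x, y). x \<in> {..<length vs} \<and> y \<in> {..<length vs}
      \<and> M (vs ! x) (vs ! y) > 0}\<^sup>*"
  proof (induction rule: rtrancl_induct)
    case (step u w)
    have "(g u, g w) \<in> {(x, y). x \<in> {..<length vs} \<and> y \<in> {..<length vs}
        \<and> M (vs ! x) (vs ! y) > 0}"
      using step.hyps(2) gv by auto
    with step.IH show ?case by (rule rtrancl_into_rtrancl)
  qed simp
  then show "(i, j) \<in> {(x, y). x \<in> {..<length vs} \<and> y \<in> {..<length vs}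
      \<and> M (vs ! x) (vs ! y) > 0}\<^sup>*"
    using gi ij by simp
qed


theorem theorem4p4:
  fixes V :: "'v set" and M :: "'v \<Rightarrow> 'v \<Rightarrow> real" and vs :: "'v list"
    and n :: nat and A :: "real mat" and a b c d :: real
  assumes "multigraph V M"
    and "n = card V"
    and "n \<ge> 2"
    and "connected_multigraph V M"
    and "distinct vs" and "set vs = V"
    and "A = adjacency_matrix vs M"
    and "strongly_regular_with n A a b c d"
  shows
    "(- d / (real n - 1) < d
       \<and> spectrum A = {- d / (real n - 1), d}
       \<and> multiplicity_of (- d / (real n - 1)) A = n - 1
       \<and> multiplicity_of d A = 1)
     \<or> (let \<eta>m = (a - sqrt (a\<^sup>2 + 4 * (c - b))) / 2;
            \<eta>p = (a + sqrt (a\<^sup>2 + 4 * (c - b))) / 2;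
            fm = (d + (real n - 1) * \<eta>p) / (\<eta>p - \<eta>m);
            fp = - ((d + (real n - 1) * \<eta>m) / (\<eta>p - \<eta>m))
        in \<eta>m < \<eta>p \<and> \<eta>p < d
           \<and> spectrum A = {\<eta>m, \<eta>p, d}
           \<and> real (multiplicity_of \<eta>m A) = fm
           \<and> real (multiplicity_of \<eta>p A) = fp
           \<and> multiplicity_of d A = 1)"
proof -
  have n: "n = length vs" using assms(2,5,6) distinct_card by metis
  have entry: "A $$ (i, j) = M (vs ! i) (vs ! j)" if "i < n" "j < n" for i j
    using that unfolding assms(7) adjacency_matrix_def n by simp
  have carrier: "A \<in> carrier_mat n n" unfolding assms(7) adjacency_matrix_def n by simp
  have mem: "vs ! i \<in> V" if "i < n" for i using that n assms(6) by auto
  interpret strongly_regular_matrix n A d a b c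
  proof
    show "A \<in> carrier_mat n n" by (rule carrier)
    show "n \<ge> 2" by (rule assms(3))
    show "multigraph {..<n} (\<lambda>i j. A $$ (i, j))"
      using assms(1) mem unfolding multigraph_def by (auto simp: entry)
    have edges: "{(x, y). x \<in> {..<n} \<and> y \<in> {..<n} \<and> A $$ (x, y) > 0}
        = {(x, y). x \<in> {..<n} \<and> y \<in> {..<n} \<and> M (vs ! x) (vs ! y) > 0}"
      by (auto simp: entry)
    show "connected_multigraph {..<n} (\<lambda>i j. A $$ (i, j))"
      using connected_multigraph_enumeration[OF assms(4,5,6)]
      unfolding connected_multigraph_def edges n[symmetric] .
    fix i assume i: "i < n"
    have "(A * all_ones n) $$ (i, i) = (d \<cdot>\<^sub>m all_ones n) $$ (i, i)"
      using assms(8) unfolding strongly_regular_with_def by simp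
    moreover have "(A * all_ones n) $$ (i, i) = (\<Sum>l<n. A $$ (i, l) * all_ones n $$ (l, i))"
      by (rule index_mult_mat_sum[OF carrier _ i i]) (simp add: all_ones_def)
    ultimately show "(\<Sum>j<n. A $$ (i, j)) = d" using i by (simp add: all_ones_def)
    fix j assume j: "j < n"
    have "A $$ (i, i) = 0" using assms(1) mem[OF i] i unfolding multigraph_def by (simp add: entry)
    then show "(\<Sum>l<n. A $$ (i, l) * A $$ (l, j)) = a * A $$ (i, j) + b + (if i = j then c - b else 0)"
      using assms(8) i j unfolding strongly_regular_with_def index_mult_mat_sum[OF carrier carrier i j, symmetric]
      by auto
  qed
  show ?thesis unfolding Let_def by (rule spectrum_dichotomy)
qed

end
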